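(* For every $n\ge1$ let $\theta_{0,n}\in\Theta_n$ and let $X^n\sim P_{\theta_{0,n},n}$ (planted bi-section model with edge probabilities $p_n,q_n\in(0,1)$). Equip every $\Theta_n$ with its uniform prior. Suppose $$n\Bigl(p_n+q_n-2p_nq_n-2\sqrt{p_n(1-p_n)q_n(1-q_n)}\Bigr)\to\infty\qquad(n\to\infty).$$ Then for any $\beta\in(0,\tfrac12)$, $$\Pi\bigl(\{\theta\in\Theta_n:k(\theta,\theta_{0,n})\ge\beta n\}\bigm|X^n\bigr)\to0\quad\text{in }P_{\theta_{0,n},n}\text{-probability, as } n\to\infty,$$ and consequently the posterior recovers $\theta_{0,n}$ almost-exactly, that is, there is a sequence $l_n=o(n)$ such that $\Pi(\{\theta\in\Theta_n:k(\theta,\theta_{0,n})\le l_n\}|X^n)\to1$ in $P_{\theta_{0,n},n}$-probability.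
   Context: Planted bi-section model. For $n\ge1$, $\Theta_n'$ is the set of $\theta'\in\{0,1\}^{2n}$ with exactly $n$ zeros and $n$ ones. Let $\neg\theta'$ denote component-wise negation, let $\sim_n$ be the equivalence relation identifying $\theta'$ with $\neg\theta'$, and let $\Theta_n=\Theta_n'/\sim_n$. Given $p_n,q_n\in(0,1)$ and $\theta\in\Theta_n$ with representative $\theta'$, $P_{\theta,n}$ is the law of the random simple undirected graph $X^n$ (no loops) on vertices $\{1,\dots,2n\}$, with adjacency indicators $X_{ij}$ ($i<j$), whose edges occur independently with $P_{\theta,n}(X_{ij}=1)=p_n$ if $\theta'_i=\theta'_j$ and $=q_n$ if $\theta'_i\ne\theta'_j$ (independent of the representative). Let $p_{\theta,n}(x^n)=P_{\theta,n}(X^n=x^n)$ be the likelihood. With the uniform prior on $\Theta_n$, the posterior is, for $A\subset\Theta_n$, $$\Pi(A|X^n)=\sum_{\theta\in A}p_{\theta,n}(X^n)\Big/\sum_{\theta\in\Theta_n}p_{\theta,n}(X^n).$$ Metric on $\Theta_n$: for $\theta_1',\theta_2'\in\Theta_n'$ put $Z(\theta')=\{i:\theta'_i=0\}$ and $k'(\theta_1',\theta_2')=|Z(\theta_1')\setminus Z(\theta_2')|$. For $\theta_1,\theta_2\in\Theta_n$ with representatives $\theta_1',\theta_2'$, $k(\theta_1,\theta_2)=\min\{k'(\theta_1',\theta_2'),k'(\theta_1',\neg\theta_2')\}\in\{0,\dots,\lfloor n/2\rfloor\}$. *)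

theory Defs
  imports "HOL-Probability.Probability" "HOL-Library.Landau_Symbols"
begin

section \<open>Class assignments up to relabelling\<close>

text \<open>Elements of \<open>{0,1}^{2n}\<close> are extensional functions on \<open>{1..2n}\<close>, that is, they are
  \<open>undefined\<close> outside this index set, so that equality of functions is equality of vectors.\<close>

definition labelings :: "nat \<Rightarrow> (nat \<Rightarrow> nat) set" where
  "labelings n = {t \<in> {1..2*n} \<rightarrow>\<^sub>E {0, 1}.
     card {i \<in> {1..2*n}. t i = 0} = n \<and> card {i \<in> {1..2*n}. t i = 1} = n}"

definition neg_labeling :: "nat \<Rightarrow> (nat \<Rightarrow> nat) \<Rightarrow> nat \<Rightarrow> nat" where
  "neg_labeling n t = (\<lambda>i \<in> {1..2*n}. 1 - t i)"

definition label_equiv :: "nat \<Rightarrow> ((nat \<Rightarrow> nat) \<times> (nat \<Rightarrow> nat)) set" where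
  "label_equiv n = {(s, t). s \<in> labelings n \<and> t \<in> labelings n \<and> (t = s \<or> t = neg_labeling n s)}"

definition Theta :: "nat \<Rightarrow> (nat \<Rightarrow> nat) set set" where
  "Theta n = labelings n // label_equiv n"

definition representative :: "(nat \<Rightarrow> nat) set \<Rightarrow> nat \<Rightarrow> nat" where
  "representative \<theta> = (SOME t. t \<in> \<theta>)"


section \<open>The planted bi-section model\<close>

definition vertex_pairs :: "nat \<Rightarrow> (nat \<times> nat) set" where
  "vertex_pairs n = {(i, j). 1 \<le> i \<and> i < j \<and> j \<le> 2*n}"

text \<open>A simple graph on \<open>{1..2n}\<close> is given by its adjacency indicators: a function that is
  \<open>True\<close> at \<open>(i, j)\<close> with \<open>i < j\<close> iff \<open>i\<close> and \<open>j\<close> are joined by an edge, and \<open>False\<close> at all pairs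
  outside \<open>vertex_pairs n\<close>.\<close>

type_synonym graph = "nat \<times> nat \<Rightarrow> bool"

definition labeled_graph_law :: "nat \<Rightarrow> real \<Rightarrow> real \<Rightarrow> (nat \<Rightarrow> nat) \<Rightarrow> graph pmf" where
  "labeled_graph_law n p q t =
     Pi_pmf (vertex_pairs n) False (\<lambda>(i, j). bernoulli_pmf (if t i = t j then p else q))"

definition planted_bisection :: "nat \<Rightarrow> real \<Rightarrow> real \<Rightarrow> (nat \<Rightarrow> nat) set \<Rightarrow> graph pmf" where
  "planted_bisection n p q \<theta> = labeled_graph_law n p q (representative \<theta>)"

definition likelihood :: "nat \<Rightarrow> real \<Rightarrow> real \<Rightarrow> (nat \<Rightarrow> nat) set \<Rightarrow> graph \<Rightarrow> real" where
  "likelihood n p q \<theta> x = pmf (planted_bisection n p q \<theta>) x"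

text \<open>The posterior for the uniform prior on \<open>Theta n\<close>; the prior weights cancel.\<close>

definition posterior ::
    "nat \<Rightarrow> real \<Rightarrow> real \<Rightarrow> (nat \<Rightarrow> nat) set set \<Rightarrow> graph \<Rightarrow> real" where
  "posterior n p q A x =
     (\<Sum>\<theta>\<in>A. likelihood n p q \<theta> x) / (\<Sum>\<theta>\<in>Theta n. likelihood n p q \<theta> x)"


section \<open>The metric\<close>

definition zeros :: "nat \<Rightarrow> (nat \<Rightarrow> nat) \<Rightarrow> nat set" where
  "zeros n t = {i \<in> {1..2*n}. t i = 0}"

definition label_dist :: "nat \<Rightarrow> (nat \<Rightarrow> nat) \<Rightarrow> (nat \<Rightarrow> nat) \<Rightarrow> nat" where
  "label_dist n s t = card (zeros n s - zeros n t)"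

definition class_dist :: "nat \<Rightarrow> (nat \<Rightarrow> nat) set \<Rightarrow> (nat \<Rightarrow> nat) set \<Rightarrow> nat" where
  "class_dist n \<theta> \<eta> =
     min (label_dist n (representative \<theta>) (representative \<eta>))
         (label_dist n (representative \<theta>) (neg_labeling n (representative \<eta>)))"


section \<open>Convergence in probability\<close>

text \<open>Each \<open>Y n\<close> is a random variable on its own probability space \<open>M n\<close>; the limit is a constant.\<close>

definition tendsto_in_probability ::
    "(nat \<Rightarrow> 'a pmf) \<Rightarrow> (nat \<Rightarrow> 'a \<Rightarrow> real) \<Rightarrow> real \<Rightarrow> bool" where
  "tendsto_in_probability M Y c \<longleftrightarrow>
     (\<forall>\<epsilon>>0. (\<lambda>n. measure_pmf.prob (M n) {x. \<bar>Y n x - c\<bar> > \<epsilon>}) \<longlonglongrightarrow> 0)"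


section \<open>Independence of the representative\<close>

lemma neg_labeling_in_labelings:
  assumes "t \<in> labelings n"
  shows "neg_labeling n t \<in> labelings n"
proof -
  have t: "t i \<in> {0, 1}" if "i \<in> {1..2*n}" for i
    using assms that unfolding labelings_def by blast
  have "{i \<in> {1..2*n}. neg_labeling n t i = 0} = {i \<in> {1..2*n}. t i = 1}"
       "{i \<in> {1..2*n}. neg_labeling n t i = 1} = {i \<in> {1..2*n}. t i = 0}"
    using t by (fastforce simp: neg_labeling_def)+
  then show ?thesis
    using assms by (auto simp: labelings_def neg_labeling_def)
qed

lemma neg_neg_labeling:
  assumes "t \<in> labelings n"
  shows "neg_labeling n (neg_labeling n t) = t"
proof
  fix i
  have ext: "t \<in> {1..2*n} \<rightarrow>\<^sub>E {0, 1}"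
    using assms by (simp add: labelings_def)
  show "neg_labeling n (neg_labeling n t) i = t i"
  proof (cases "i \<in> {1..2*n}")
    case True
    then have "t i = 0 \<or> t i = 1" using ext by blast
    then show ?thesis using True by (auto simp: neg_labeling_def)
  next
    case False
    then show ?thesis using ext by (auto simp: neg_labeling_def PiE_def extensional_def)
  qed
qed

lemma equiv_label_equiv: "equiv (labelings n) (label_equiv n)"
proof (rule equivI)
  show "label_equiv n \<subseteq> labelings n \<times> labelings n"
    by (auto simp: label_equiv_def)
  show "refl_on (labelings n) (label_equiv n)"
    by (auto simp: refl_on_def label_equiv_def)
  show "sym (label_equiv n)"
    by (auto simp: sym_def label_equiv_def neg_neg_labeling)
  show "trans (label_equiv n)"
    by (auto simp: trans_def label_equiv_def neg_neg_labeling)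
qed

lemma representative_in:
  assumes "\<theta> \<in> Theta n"
  shows "representative \<theta> \<in> \<theta>"
  using in_quotient_imp_non_empty[OF equiv_label_equiv] assms
  unfolding Theta_def representative_def by (metis ex_in_conv someI)

lemma Theta_elem_cases:
  assumes "\<theta> \<in> Theta n" "s \<in> \<theta>" "t \<in> \<theta>"
  shows "s \<in> labelings n" "t \<in> labelings n" "t = s \<or> t = neg_labeling n s"
  using quotient_eq_iff[OF equiv_label_equiv] assms
    in_quotient_imp_in_rel[OF equiv_label_equiv, of \<theta> n s t]
  unfolding Theta_def by (auto simp: label_equiv_def)

lemma labeled_graph_law_neg:
  assumes "t \<in> labelings n"
  shows "labeled_graph_law n p q (neg_labeling n t) = labeled_graph_law n p q t"
proof -
  have t: "t i = 0 \<or> t i = 1" if "i \<in> {1..2*n}" for i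
    using assms that unfolding labelings_def by blast
  have "neg_labeling n t i = neg_labeling n t j \<longleftrightarrow> t i = t j"
    if "(i, j) \<in> vertex_pairs n" for i j
    using that t[of i] t[of j] by (auto simp: neg_labeling_def vertex_pairs_def)
  moreover have "finite (vertex_pairs n)"
    by (rule finite_subset[of _ "{..2*n} \<times> {..2*n}"]) (auto simp: vertex_pairs_def)
  ultimately show ?thesis
    unfolding labeled_graph_law_def by (intro Pi_pmf_cong) auto
qed

lemma planted_bisection_eq:
  assumes "\<theta> \<in> Theta n" "t \<in> \<theta>"
  shows "planted_bisection n p q \<theta> = labeled_graph_law n p q t"
  using Theta_elem_cases[OF assms(1) assms(2) representative_in[OF assms(1)]]
  by (auto simp: planted_bisection_def labeled_graph_law_neg)

lemma zeros_neg_labeling: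
  assumes "t \<in> labelings n"
  shows "zeros n (neg_labeling n t) = {1..2*n} - zeros n t"
proof -
  have "t i = 0 \<or> t i = 1" if "i \<in> {1..2*n}" for i
    using assms that unfolding labelings_def by blast
  then show ?thesis by (fastforce simp: zeros_def neg_labeling_def)
qed

lemma label_dist_neg_neg:
  assumes "s \<in> labelings n" "t \<in> labelings n"
  shows "label_dist n (neg_labeling n s) (neg_labeling n t) = label_dist n s t"
proof -
  have fin: "finite (zeros n s)" "finite (zeros n t)"
    by (auto simp: zeros_def)
  have "card (zeros n s) = card (zeros n t)"
    using assms by (simp add: labelings_def zeros_def)
  then have "card (zeros n t - zeros n s) = card (zeros n s - zeros n t)"
    using fin by (simp add: card_Diff_subset_Int Int_commute)
  moreover have "({1..2*n} - zeros n s) - ({1..2*n} - zeros n t) = zeros n t - zeros n s"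
    by (auto simp: zeros_def)
  ultimately show ?thesis
    using assms by (simp add: label_dist_def zeros_neg_labeling)
qed

lemma class_dist_eq:
  assumes "\<theta> \<in> Theta n" "\<eta> \<in> Theta n" "s \<in> \<theta>" "t \<in> \<eta>"
  shows "class_dist n \<theta> \<eta> = min (label_dist n s t) (label_dist n s (neg_labeling n t))"
proof -
  note r = Theta_elem_cases[OF assms(1,3) representative_in[OF assms(1)]]
           Theta_elem_cases[OF assms(2,4) representative_in[OF assms(2)]]
  have "label_dist n (neg_labeling n s) t = label_dist n s (neg_labeling n t)"
    using label_dist_neg_neg[OF r(1) neg_labeling_in_labelings[OF r(4)]] r
    by (simp add: neg_neg_labeling)
  then show ?thesis
    using r by (auto simp: class_dist_def neg_neg_labeling label_dist_neg_neg min.commute)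
qed

end

theory Submission
  imports Defs
begin

text \<open>
  The proof is a union bound over the classes far from the truth, in which the posterior weight of
  a single class is controlled by a Hellinger affinity.

  The posterior weight of \<open>\<theta>\<close> is at most \<open>sqrt (L\<^sub>\<theta> / L\<^sub>0)\<close>, where \<open>L\<^sub>\<theta>\<close> and \<open>L\<^sub>0\<close> are the
  likelihoods of \<open>\<theta>\<close> and of the truth. Its expectation under the truth is the Hellinger affinity
  of the two graph laws; by independence of the edges it is a product over vertex pairs, in which
  a pair contributes \<open>1\<close> if the labelings agree on whether its endpoints share a class and
  \<open>\<rho> = sqrt (p q) + sqrt ((1 - p) (1 - q))\<close> otherwise (\<open>expectation_sqrt_likelihood_ratio\<close>).
  Two labelings at distance \<open>k\<close> disagree on exactly \<open>4 k (n - k)\<close> pairs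
  (\<open>card_disagreeing_pairs_labelings\<close>), and \<open>\<rho>\<^sup>2 = 1 - \<delta>\<close> where \<open>n \<delta>\<close> is the quantity
  assumed to diverge. After \<open>k\<close> has been minimised over the two representatives,
  \<open>n - k \<ge> n / 2\<close>, so the affinity is at most \<open>exp (- \<delta> k n)\<close>.

  There are at most \<open>4 ^ n\<close> classes, so the expected posterior mass of \<open>{k \<ge> \<beta> n}\<close> is at most
  \<open>exp (n (ln 4 - \<beta> n \<delta>))\<close> (\<open>expectation_posterior_far\<close>). This vanishes as soon as
  \<open>\<beta> n \<delta> \<rightarrow> \<infinity>\<close>, even when \<open>\<beta>\<close> depends on \<open>n\<close>. A fixed \<open>\<beta>\<close> gives the first claim; the choice
  \<open>\<beta> = 1 / sqrt (n \<delta>)\<close>, which tends to \<open>0\<close>, gives the second one with \<open>l\<^sub>n = \<beta> n\<close>.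
\<close>

section \<open>The Hellinger affinity of two edge laws\<close>

definition hellinger_affinity :: "real \<Rightarrow> real \<Rightarrow> real" where
  "hellinger_affinity p q = sqrt (p * q) + sqrt ((1 - p) * (1 - q))"

text \<open>One minus the squared affinity, by \<open>separation_eq\<close>.\<close>

definition separation :: "real \<Rightarrow> real \<Rightarrow> real" where
  "separation p q = p + q - 2 * p * q - 2 * sqrt (p * (1 - p) * q * (1 - q))"

lemma separation_eq:
  assumes "p \<in> {0<..<1}" "q \<in> {0<..<1}"
  shows "separation p q = 1 - (hellinger_affinity p q)\<^sup>2"
proof -
  have "sqrt (p * (1 - p) * q * (1 - q)) = sqrt (p * q) * sqrt ((1 - p) * (1 - q))"
    by (simp add: real_sqrt_mult[symmetric] mult_ac)
  then show ?thesis
    using assms by (simp add: separation_def hellinger_affinity_def power2_sum) (simp add: algebra_simps)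
qed

lemma separation_nonneg:
  assumes "p \<in> {0<..<1}" "q \<in> {0<..<1}"
  shows "separation p q \<ge> 0"
proof -
  have "sqrt (p * (1 - p) * q * (1 - q)) = sqrt (p * (1 - q)) * sqrt (q * (1 - p))"
    by (simp add: real_sqrt_mult[symmetric] mult_ac)
  then have "separation p q = (sqrt (p * (1 - q)) - sqrt (q * (1 - p)))\<^sup>2"
    using assms by (simp add: separation_def power2_diff) (simp add: algebra_simps)
  then show ?thesis by simp
qed

lemma hellinger_affinity_commute: "hellinger_affinity p q = hellinger_affinity q p"
  by (simp add: hellinger_affinity_def mult.commute)

lemma hellinger_affinity_self: "p \<in> {0<..<1} \<Longrightarrow> hellinger_affinity p p = 1"
  by (simp add: hellinger_affinity_def)

lemma hellinger_affinity_even_power_le: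
  assumes "p \<in> {0<..<1}" "q \<in> {0<..<1}"
  shows "hellinger_affinity p q ^ (2 * m) \<le> exp (- (separation p q * real m))"
proof -
  have "hellinger_affinity p q ^ (2 * m) = (1 - separation p q) ^ m"
    using assms by (simp add: separation_eq power_mult)
  also have "\<dots> \<le> exp (- separation p q) ^ m"
    using assms exp_ge_add_one_self[of "- separation p q"]
    by (intro power_mono) (auto simp: separation_eq)
  also have "\<dots> = exp (- (separation p q * real m))"
    by (simp add: exp_of_nat_mult[symmetric] mult.commute)
  finally show ?thesis .
qed

lemma expectation_sqrt_bernoulli_ratio:
  assumes "a \<in> {0<..<1}" "b \<in> {0<..<1}"
  shows "measure_pmf.expectation (bernoulli_pmf b)
           (\<lambda>v. sqrt (pmf (bernoulli_pmf a) v / pmf (bernoulli_pmf b) v)) = hellinger_affinity a b"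
proof -
  have "y * sqrt (x / y) = sqrt (x * y)" if "y > 0" for x y :: real
    using that by (simp add: real_sqrt_divide real_sqrt_mult real_div_sqrt flip: times_divide_eq_left)
  from this[of b a] this[of "1 - b" "1 - a"] show ?thesis
    using assms by (simp add: hellinger_affinity_def mult.commute)
qed


section \<open>Pairs on which two labelings disagree\<close>

definition disagreeing_pairs :: "nat \<Rightarrow> (nat \<Rightarrow> nat) \<Rightarrow> (nat \<Rightarrow> nat) \<Rightarrow> (nat \<times> nat) set" where
  "disagreeing_pairs n s t = {(i, j) \<in> vertex_pairs n. (s i = s j) \<noteq> (t i = t j)}"

lemma finite_vertex_pairs: "finite (vertex_pairs n)"
  by (rule finite_subset[of _ "{..2*n} \<times> {..2*n}"]) (auto simp: vertex_pairs_def)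

text \<open>For labels in \<open>{0, 1}\<close>, the labelings disagree on a pair iff exactly one of its endpoints is
  relabelled, so the disagreeing pairs form the cut between the relabelled vertices and the rest.\<close>

lemma card_disagreeing_pairs_cut:
  assumes s: "\<And>i. i \<in> {1..2*n} \<Longrightarrow> s i \<in> {0, 1}" and t: "\<And>i. i \<in> {1..2*n} \<Longrightarrow> t i \<in> {0, 1}"
  defines "U \<equiv> {i \<in> {1..2*n}. s i \<noteq> t i}"
  shows "card (disagreeing_pairs n s t) = card U * card ({1..2*n} - U)"
proof -
  let ?V = "{1..2*n} - U" and ?f = "\<lambda>(a, b). (min a b, max a b)"
  have cut: "(s i = s j) \<noteq> (t i = t j) \<longleftrightarrow> (i \<in> U) \<noteq> (j \<in> U)"
    if "i \<in> {1..2*n}" "j \<in> {1..2*n}" for i j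
    using s[OF that(1)] s[OF that(2)] t[OF that(1)] t[OF that(2)] that by (auto simp: U_def)
  have "disagreeing_pairs n s t = {(i, j) \<in> vertex_pairs n. (i \<in> U) \<noteq> (j \<in> U)}"
    unfolding disagreeing_pairs_def
  proof (intro Collect_cong, clarify, intro conj_cong refl)
    fix i j assume "(i, j) \<in> vertex_pairs n"
    then show "(s i = s j) \<noteq> (t i = t j) \<longleftrightarrow> (i \<in> U) \<noteq> (j \<in> U)"
      by (intro cut) (auto simp: vertex_pairs_def)
  qed
  also have "\<dots> = ?f ` (U \<times> ?V)"
  proof (intro equalityI subsetI)
    fix x assume "x \<in> {(i, j) \<in> vertex_pairs n. (i \<in> U) \<noteq> (j \<in> U)}"
    then obtain i j where x: "x = (i, j)" "1 \<le> i" "i < j" "j \<le> 2 * n" "(i \<in> U) \<noteq> (j \<in> U)"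
      by (auto simp: vertex_pairs_def)
    show "x \<in> ?f ` (U \<times> ?V)"
    proof (cases "i \<in> U")
      case True
      then show ?thesis using x by (intro image_eqI[of _ _ "(i, j)"]) auto
    next
      case False
      then show ?thesis using x by (intro image_eqI[of _ _ "(j, i)"]) auto
    qed
  next
    fix x assume "x \<in> ?f ` (U \<times> ?V)"
    then obtain a b where ab: "x = ?f (a, b)" "a \<in> U" "b \<in> ?V" by auto
    then have "a \<noteq> b" "a \<in> {1..2*n}" "b \<in> {1..2*n}" by (auto simp: U_def)
    then show "x \<in> {(i, j) \<in> vertex_pairs n. (i \<in> U) \<noteq> (j \<in> U)}"
      using ab by (cases "a < b") (auto simp: vertex_pairs_def min_def max_def)
  qed
  also have "card \<dots> = card (U \<times> ?V)"
    by (intro card_image) (auto simp: inj_on_def min_def max_def split: if_splits)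
  finally show ?thesis by (simp add: card_cartesian_product)
qed

lemma labelings_values: "t \<in> labelings n \<Longrightarrow> i \<in> {1..2*n} \<Longrightarrow> t i \<in> {0, 1}"
  unfolding labelings_def by blast

lemma card_zeros: "t \<in> labelings n \<Longrightarrow> card (zeros n t) = n"
  by (simp add: labelings_def zeros_def)

lemma finite_zeros: "finite (zeros n t)"
  by (simp add: zeros_def)

lemma label_dist_commute:
  assumes "s \<in> labelings n" "t \<in> labelings n"
  shows "label_dist n s t = label_dist n t s"
  using assms
  by (simp add: label_dist_def card_Diff_subset_Int finite_zeros card_zeros Int_commute)

lemma label_dist_le: "s \<in> labelings n \<Longrightarrow> label_dist n s t \<le> n"
  unfolding label_dist_def by (metis Diff_subset card_mono card_zeros finite_zeros)

lemma label_dist_neg: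
  assumes "s \<in> labelings n" "t \<in> labelings n"
  shows "label_dist n s (neg_labeling n t) = n - label_dist n s t"
proof -
  have "zeros n s - ({1..2*n} - zeros n t) = zeros n s \<inter> zeros n t"
    by (auto simp: zeros_def)
  moreover have "card (zeros n s \<inter> zeros n t) \<le> n"
    using card_mono[OF finite_zeros, of "zeros n s \<inter> zeros n t" n s] card_zeros[OF assms(1)] by simp
  ultimately show ?thesis
    using assms
    by (simp add: label_dist_def zeros_neg_labeling card_Diff_subset_Int finite_zeros card_zeros)
qed

text \<open>Passing from one labeling to the other relabels \<open>k\<close> zeros and, since the classes are
  balanced, \<open>k\<close> ones.\<close>

lemma card_disagreeing_pairs_labelings:
  assumes "s \<in> labelings n" "t \<in> labelings n"
  shows "card (disagreeing_pairs n s t) = 4 * (label_dist n s t * (n - label_dist n s t))"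
proof -
  let ?U = "{i \<in> {1..2*n}. s i \<noteq> t i}"
  have "s i = 0 \<or> s i = 1" "t i = 0 \<or> t i = 1" if "i \<in> {1..2*n}" for i
    using labelings_values[OF assms(1) that] labelings_values[OF assms(2) that] by auto
  then have "?U = (zeros n s - zeros n t) \<union> (zeros n t - zeros n s)"
    by (fastforce simp: zeros_def)
  also have "card \<dots> = label_dist n s t + label_dist n t s"
    unfolding label_dist_def by (intro card_Un_disjoint) (auto simp: finite_zeros)
  finally have U: "card ?U = 2 * label_dist n s t"
    using label_dist_commute[OF assms] by simp
  have "card ({1..2*n} - ?U) = 2 * n - card ?U"
    by (subst card_Diff_subset) auto
  then have "card ({1..2*n} - ?U) = 2 * (n - label_dist n s t)"
    using U by simp
  then show ?thesis
    using card_disagreeing_pairs_cut[of n s t] labelings_values[OF assms(1)]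
      labelings_values[OF assms(2)] U by simp
qed

lemma card_Theta_le: "card (Theta n) \<le> 4 ^ n" "finite (Theta n)"
proof -
  have sub: "labelings n \<subseteq> {1..2*n} \<rightarrow>\<^sub>E {0, 1}"
    by (auto simp: labelings_def)
  have fin: "finite ({1..2*n} \<rightarrow>\<^sub>E {0, 1::nat})"
    by (intro finite_PiE) auto
  have "card ({1..2*n} \<rightarrow>\<^sub>E {0, 1::nat}) = 4 ^ n"
    by (simp add: card_PiE power_mult flip: numeral_2_eq_2)
  then have lab: "card (labelings n) \<le> 4 ^ n"
    using card_mono[OF fin sub] by simp
  have "Theta n = (\<lambda>s. label_equiv n `` {s}) ` labelings n"
    by (auto simp: Theta_def quotient_def)
  then show "card (Theta n) \<le> 4 ^ n" "finite (Theta n)"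
    using lab card_image_le[OF finite_subset[OF sub fin]] finite_subset[OF sub fin]
    by (auto intro: order_trans)
qed


section \<open>The expected posterior mass away from the truth\<close>

lemma finite_set_labeled_graph_law: "finite (set_pmf (labeled_graph_law n p q t))"
proof -
  have "finite (PiE_dflt (vertex_pairs n) False (\<lambda>_. UNIV :: bool set))"
    by (intro finite_PiE_dflt finite_vertex_pairs) auto
  moreover have "set_pmf (labeled_graph_law n p q t) \<subseteq> PiE_dflt (vertex_pairs n) False (\<lambda>_. UNIV)"
    unfolding labeled_graph_law_def
    using set_Pi_pmf_subset[OF finite_vertex_pairs] by (fastforce simp: PiE_dflt_def)
  ultimately show ?thesis by (rule finite_subset[rotated])
qed

lemma finite_set_planted_bisection: "finite (set_pmf (planted_bisection n p q \<theta>))"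
  by (simp add: planted_bisection_def finite_set_labeled_graph_law)

lemma sqrt_prod: "sqrt (\<Prod>a\<in>A. f a) = (\<Prod>a\<in>A. sqrt (f a))"
  by (induction A rule: infinite_finite_induct) (auto simp: real_sqrt_mult)

text \<open>Integrating the root of the likelihood ratio against the reference law yields the affinity
  \<open>\<Sum>x. sqrt (L\<^sub>s x * L\<^sub>t x)\<close>, which factorises over independent edges.\<close>

lemma expectation_sqrt_likelihood_ratio:
  assumes pq: "p \<in> {0<..<1}" "q \<in> {0<..<1}"
  shows "measure_pmf.expectation (labeled_graph_law n p q t)
           (\<lambda>x. sqrt (pmf (labeled_graph_law n p q s) x / pmf (labeled_graph_law n p q t) x)) =
         hellinger_affinity p q ^ card (disagreeing_pairs n s t)"
proof -
  let ?V = "vertex_pairs n"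
  define r :: "(nat \<Rightarrow> nat) \<Rightarrow> nat \<times> nat \<Rightarrow> real"
    where "r u e = (if u (fst e) = u (snd e) then p else q)" for u e
  define g where "g e v = sqrt (pmf (bernoulli_pmf (r s e)) v / pmf (bernoulli_pmf (r t e)) v)" for e v
  have r: "r u e \<in> {0<..<1}" for u e
    using pq by (simp add: r_def)
  have law: "labeled_graph_law n p q u = Pi_pmf ?V False (\<lambda>e. bernoulli_pmf (r u e))" for u
    by (simp add: labeled_graph_law_def r_def case_prod_unfold)
  have fin: "finite (set_pmf (Pi_pmf ?V False (\<lambda>e. bernoulli_pmf (r t e))))"
    using finite_set_labeled_graph_law by (simp flip: law)
  have ratio: "sqrt (pmf (labeled_graph_law n p q s) x / pmf (labeled_graph_law n p q t) x)
                 = (\<Prod>e\<in>?V. g e (x e))"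
    if "x \<in> set_pmf (Pi_pmf ?V False (\<lambda>e. bernoulli_pmf (r t e)))" for x
  proof -
    have "x e = False" if "e \<notin> ?V" for e
      using \<open>x \<in> _\<close> that set_Pi_pmf_subset[OF finite_vertex_pairs] by fast
    then show ?thesis
      unfolding law g_def
      by (simp add: pmf_Pi' finite_vertex_pairs prod_dividef[symmetric] sqrt_prod)
  qed
  have "measure_pmf.expectation (labeled_graph_law n p q t)
          (\<lambda>x. sqrt (pmf (labeled_graph_law n p q s) x / pmf (labeled_graph_law n p q t) x)) =
        measure_pmf.expectation (Pi_pmf ?V False (\<lambda>e. bernoulli_pmf (r t e))) (\<lambda>x. \<Prod>e\<in>?V. g e (x e))"
    unfolding law by (intro integral_cong_AE AE_pmfI) (auto simp: ratio[unfolded law])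
  also have "\<dots> = (\<Prod>e\<in>?V. measure_pmf.expectation (bernoulli_pmf (r t e)) (g e))"
    by (intro expectation_prod_Pi_pmf finite_vertex_pairs integrable_measure_pmf_finite)
      (auto simp: g_def)
  also have "\<dots> = (\<Prod>e\<in>?V. hellinger_affinity (r s e) (r t e))"
    unfolding g_def by (intro prod.cong refl expectation_sqrt_bernoulli_ratio r)
  also have "\<dots> = (\<Prod>e\<in>?V. if e \<in> disagreeing_pairs n s t then hellinger_affinity p q else 1)"
    using pq by (intro prod.cong refl)
      (auto simp: r_def disagreeing_pairs_def hellinger_affinity_self hellinger_affinity_commute)
  also have "\<dots> = (\<Prod>e\<in>?V \<inter> disagreeing_pairs n s t. hellinger_affinity p q)"
    by (simp add: prod.inter_restrict[symmetric] finite_vertex_pairs)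
  also have "\<dots> = hellinger_affinity p q ^ card (disagreeing_pairs n s t)"
    by (simp add: disagreeing_pairs_def Int_def case_prod_unfold conj_commute conj_left_commute)
  finally show ?thesis .
qed

lemma expectation_sqrt_likelihood_ratio_class:
  assumes pq: "p \<in> {0<..<1}" "q \<in> {0<..<1}" and \<theta>: "\<theta> \<in> Theta n" "\<eta> \<in> Theta n"
  shows "measure_pmf.expectation (planted_bisection n p q \<eta>)
           (\<lambda>x. sqrt (likelihood n p q \<theta> x / likelihood n p q \<eta> x))
         \<le> exp (- (separation p q * real (class_dist n \<theta> \<eta>) * real n))"
proof -
  define s t where "s = representative \<theta>" and "t = representative \<eta>"
  have st: "s \<in> labelings n" "t \<in> labelings n"
    unfolding s_def t_def using \<theta> by (meson Theta_elem_cases(1) representative_in)+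
  define k where "k = label_dist n s t"
  have "k \<le> n" unfolding k_def by (rule label_dist_le[OF st(1)])
  have dist: "class_dist n \<theta> \<eta> = min k (n - k)"
    by (simp add: class_dist_def k_def label_dist_neg[OF st] flip: s_def t_def)
  (* The larger of k and n - k is at least n / 2. *)
  have half: "real (class_dist n \<theta> \<eta>) * real n \<le> real (2 * (k * (n - k)))"
  proof -
    have "min k (n - k) * n \<le> min k (n - k) * (2 * max k (n - k))"
      using \<open>k \<le> n\<close> by (intro mult_left_mono) auto
    also have "\<dots> = 2 * (k * (n - k))"
      by (simp add: min_def max_def)
    finally show ?thesis
      unfolding dist by (metis of_nat_le_iff of_nat_mult)
  qed
  have "measure_pmf.expectation (planted_bisection n p q \<eta>)
           (\<lambda>x. sqrt (likelihood n p q \<theta> x / likelihood n p q \<eta> x)) =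
        hellinger_affinity p q ^ (2 * (2 * (k * (n - k))))"
    using expectation_sqrt_likelihood_ratio[OF pq, of n t s]
    by (simp add: likelihood_def planted_bisection_def k_def
        card_disagreeing_pairs_labelings[OF st] flip: s_def t_def)
  also have "\<dots> \<le> exp (- (separation p q * real (2 * (k * (n - k)))))"
    by (rule hellinger_affinity_even_power_le[OF pq])
  also have "\<dots> \<le> exp (- (separation p q * real (class_dist n \<theta> \<eta>) * real n))"
    using mult_left_mono[OF half separation_nonneg[OF pq]] by (simp add: mult.assoc)
  finally show ?thesis .
qed

lemma posterior_nonneg: "posterior n p q A x \<ge> 0"
  by (simp add: posterior_def likelihood_def sum_nonneg)

text \<open>A posterior weight \<open>w \<le> 1\<close> satisfies \<open>w \<le> sqrt w\<close>, and under the root the normalising sum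
  may be replaced by the single likelihood of the truth.\<close>

lemma posterior_le_sum_sqrt_ratio:
  assumes A: "A \<subseteq> Theta n" and \<eta>: "\<eta> \<in> Theta n"
    and x: "x \<in> set_pmf (planted_bisection n p q \<eta>)"
  shows "posterior n p q A x \<le> (\<Sum>\<theta>\<in>A. sqrt (likelihood n p q \<theta> x / likelihood n p q \<eta> x))"
proof -
  let ?L = "\<lambda>\<theta>. likelihood n p q \<theta> x" and ?S = "\<Sum>\<theta>\<in>Theta n. likelihood n p q \<theta> x"
  have pos: "?L \<eta> > 0"
    using x by (simp add: likelihood_def pmf_positive)
  have le_S: "?L \<theta> \<le> ?S" if "\<theta> \<in> Theta n" for \<theta>
    using that by (intro member_le_sum card_Theta_le(2)) (auto simp: likelihood_def)
  have S: "?S > 0" using pos le_S[OF \<eta>] by linarith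
  have "?L \<theta> / ?S \<le> sqrt (?L \<theta> / ?L \<eta>)" if "\<theta> \<in> A" for \<theta>
  proof -
    have nn: "?L \<theta> \<ge> 0" by (simp add: likelihood_def)
    have w: "?L \<theta> / ?S \<le> 1" "?L \<theta> / ?S \<ge> 0"
      using le_S[of \<theta>] that A S nn by auto
    have "?L \<theta> / ?S \<le> sqrt (?L \<theta> / ?S)"
      using mult_left_le[OF w] by (intro real_le_rsqrt) (simp only: power2_eq_square)
    also have "\<dots> \<le> sqrt (?L \<theta> / ?L \<eta>)"
      using nn pos le_S[OF \<eta>] by (intro real_sqrt_le_mono divide_left_mono) auto
    finally show ?thesis .
  qed
  then show ?thesis
    by (simp add: posterior_def sum_divide_distrib sum_mono)
qed

lemma expectation_posterior_far:
  assumes pq: "p \<in> {0<..<1}" "q \<in> {0<..<1}" and \<eta>: "\<eta> \<in> Theta n"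
  shows "measure_pmf.expectation (planted_bisection n p q \<eta>)
           (posterior n p q {\<theta> \<in> Theta n. real (class_dist n \<theta> \<eta>) \<ge> \<beta> * real n})
         \<le> exp (real n * (ln 4 - \<beta> * (real n * separation p q)))"
proof -
  let ?P = "planted_bisection n p q \<eta>"
  let ?A = "{\<theta> \<in> Theta n. real (class_dist n \<theta> \<eta>) \<ge> \<beta> * real n}"
  let ?R = "\<lambda>\<theta> x. sqrt (likelihood n p q \<theta> x / likelihood n p q \<eta> x)"
  let ?B = "exp (- (separation p q * (\<beta> * real n) * real n))"
  note int = integrable_measure_pmf_finite[OF finite_set_planted_bisection]
  have "measure_pmf.expectation ?P (posterior n p q ?A)
          \<le> measure_pmf.expectation ?P (\<lambda>x. \<Sum>\<theta>\<in>?A. ?R \<theta> x)"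
    by (intro integral_mono_AE int AE_pmfI posterior_le_sum_sqrt_ratio \<eta>) auto
  also have "\<dots> = (\<Sum>\<theta>\<in>?A. measure_pmf.expectation ?P (?R \<theta>))"
    by (intro Bochner_Integration.integral_sum int)
  also have "\<dots> \<le> (\<Sum>\<theta>\<in>?A. ?B)"
  proof (rule sum_mono)
    fix \<theta> assume \<theta>: "\<theta> \<in> ?A"
    have "separation p q * (\<beta> * real n) * real n
            \<le> separation p q * real (class_dist n \<theta> \<eta>) * real n"
      using \<theta> separation_nonneg[OF pq] by (intro mult_right_mono mult_left_mono) auto
    then show "measure_pmf.expectation ?P (?R \<theta>) \<le> ?B"
      using expectation_sqrt_likelihood_ratio_class[OF pq _ \<eta>, of \<theta>] \<theta> by (force intro: order_trans)
  qed
  also have "\<dots> = real (card ?A) * ?B" by simp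
  also have "\<dots> \<le> 4 ^ n * ?B"
  proof (rule mult_right_mono)
    have "card ?A \<le> 4 ^ n"
      using card_mono[OF card_Theta_le(2), of ?A n] card_Theta_le(1)[of n] by force
    then show "real (card ?A) \<le> 4 ^ n"
      by (metis of_nat_le_iff of_nat_numeral of_nat_power)
  qed simp
  also have "(4::real) ^ n = exp (real n * ln 4)"
    by (simp add: exp_of_nat_mult)
  also have "\<dots> * ?B = exp (real n * (ln 4 - \<beta> * (real n * separation p q)))"
    by (simp add: exp_add[symmetric] algebra_simps)
  finally show ?thesis .
qed


section \<open>Convergence in probability\<close>

lemma posterior_far_tendsto:
  fixes p q \<beta> :: "nat \<Rightarrow> real" and \<theta>0 :: "nat \<Rightarrow> (nat \<Rightarrow> nat) set"
  assumes p: "\<And>n. n \<ge> 1 \<Longrightarrow> p n \<in> {0<..<1}" and q: "\<And>n. n \<ge> 1 \<Longrightarrow> q n \<in> {0<..<1}"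
    and \<theta>0: "\<And>n. n \<ge> 1 \<Longrightarrow> \<theta>0 n \<in> Theta n"
    and lim: "filterlim (\<lambda>n. \<beta> n * (real n * separation (p n) (q n))) at_top sequentially"
  shows "tendsto_in_probability (\<lambda>n. planted_bisection n (p n) (q n) (\<theta>0 n))
           (\<lambda>n. posterior n (p n) (q n)
              {\<theta> \<in> Theta n. real (class_dist n \<theta> (\<theta>0 n)) \<ge> \<beta> n * real n}) 0"
  unfolding tendsto_in_probability_def
proof (intro allI impI)
  fix \<epsilon> :: real assume \<epsilon>: "\<epsilon> > 0"
  let ?P = "\<lambda>n. planted_bisection n (p n) (q n) (\<theta>0 n)"
  let ?Y = "\<lambda>n. posterior n (p n) (q n)
              {\<theta> \<in> Theta n. real (class_dist n \<theta> (\<theta>0 n)) \<ge> \<beta> n * real n}"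
  have "filterlim (\<lambda>n. - ln 4 + \<beta> n * (real n * separation (p n) (q n))) at_top sequentially"
    by (rule filterlim_tendsto_add_at_top[OF tendsto_const lim])
  then have "filterlim (\<lambda>n. real n * (- ln 4 + \<beta> n * (real n * separation (p n) (q n))))
               at_top sequentially"
    by (intro filterlim_at_top_mult_at_top filterlim_real_sequentially)
  then have "filterlim (\<lambda>n. - (real n * (- ln 4 + \<beta> n * (real n * separation (p n) (q n)))))
               at_bot sequentially"
    by (simp add: filterlim_uminus_at_top)
  then have "filterlim (\<lambda>n. real n * (ln 4 - \<beta> n * (real n * separation (p n) (q n))))
               at_bot sequentially"
    by (simp add: algebra_simps)
  then have "(\<lambda>n. exp (real n * (ln 4 - \<beta> n * (real n * separation (p n) (q n))))) \<longlonglongrightarrow> 0"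
    by (rule filterlim_compose[OF exp_at_bot])
  then have bound:
    "(\<lambda>n. exp (real n * (ln 4 - \<beta> n * (real n * separation (p n) (q n)))) / \<epsilon>) \<longlonglongrightarrow> 0"
    by (rule tendsto_divide_zero)
  show "(\<lambda>n. measure_pmf.prob (?P n) {x. \<bar>?Y n x - 0\<bar> > \<epsilon>}) \<longlonglongrightarrow> 0"
  proof (rule tendsto_sandwich[OF _ _ tendsto_const bound])
    show "\<forall>\<^sub>F n in sequentially. measure_pmf.prob (?P n) {x. \<bar>?Y n x - 0\<bar> > \<epsilon>}
        \<le> exp (real n * (ln 4 - \<beta> n * (real n * separation (p n) (q n)))) / \<epsilon>"
      using eventually_ge_at_top[of 1]
    proof eventually_elim
      case (elim n)
      have "measure_pmf.prob (?P n) {x. \<bar>?Y n x - 0\<bar> > \<epsilon>} \<le> measure_pmf.prob (?P n) {x. ?Y n x \<ge> \<epsilon>}"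
        using posterior_nonneg by (intro measure_pmf.finite_measure_mono) auto
      also have "\<dots> \<le> measure_pmf.expectation (?P n) (?Y n) / \<epsilon>"
        using integral_Markov_inequality_measure[of "?P n" "?Y n" "{}" \<epsilon>,
            OF integrable_measure_pmf_finite[OF finite_set_planted_bisection]]
          posterior_nonneg \<epsilon> by simp
      also have "\<dots> \<le> exp (real n * (ln 4 - \<beta> n * (real n * separation (p n) (q n)))) / \<epsilon>"
        using expectation_posterior_far[OF p[OF elim] q[OF elim] \<theta>0[OF elim]] \<epsilon>
        by (intro divide_right_mono) auto
      finally show ?case .
    qed
  qed simp
qed

text \<open>The pointwise bound is only asked for on the support: the posterior has total mass one
  where the normalising sum is positive, in particular at graphs of positive probability.\<close>

lemma tendsto_in_probability_complement:
  assumes M: "tendsto_in_probability M Y 0"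
    and le: "\<forall>\<^sub>F n in sequentially. \<forall>x\<in>set_pmf (M n). \<bar>Z n x - 1\<bar> \<le> \<bar>Y n x\<bar>"
  shows "tendsto_in_probability M Z 1"
  unfolding tendsto_in_probability_def
proof (intro allI impI)
  fix \<epsilon> :: real assume "\<epsilon> > 0"
  then have lim: "(\<lambda>n. measure_pmf.prob (M n) {x. \<bar>Y n x - 0\<bar> > \<epsilon>}) \<longlonglongrightarrow> 0"
    using M by (simp add: tendsto_in_probability_def)
  show "(\<lambda>n. measure_pmf.prob (M n) {x. \<bar>Z n x - 1\<bar> > \<epsilon>}) \<longlonglongrightarrow> 0"
  proof (rule tendsto_sandwich[OF _ _ tendsto_const lim])
    show "\<forall>\<^sub>F n in sequentially. measure_pmf.prob (M n) {x. \<bar>Z n x - 1\<bar> > \<epsilon>}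
            \<le> measure_pmf.prob (M n) {x. \<bar>Y n x - 0\<bar> > \<epsilon>}"
      using le
    proof eventually_elim
      case (elim n)
      then show ?case
        by (intro measure_pmf.finite_measure_mono_AE AE_pmfI) force+
    qed
  qed simp
qed

lemma posterior_near_error_le:
  assumes \<eta>: "\<eta> \<in> Theta n" and x: "x \<in> set_pmf (planted_bisection n p q \<eta>)"
  shows "\<bar>posterior n p q {\<theta> \<in> Theta n. real (class_dist n \<theta> \<eta>) \<le> l} x - 1\<bar>
           \<le> \<bar>posterior n p q {\<theta> \<in> Theta n. real (class_dist n \<theta> \<eta>) \<ge> l} x\<bar>"
proof -
  let ?L = "\<lambda>\<theta>. likelihood n p q \<theta> x" and ?S = "\<Sum>\<theta>\<in>Theta n. likelihood n p q \<theta> x"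
  let ?N = "{\<theta> \<in> Theta n. real (class_dist n \<theta> \<eta>) \<le> l}"
  let ?F = "{\<theta> \<in> Theta n. real (class_dist n \<theta> \<eta>) \<ge> l}"
  have "?L \<eta> > 0"
    using x by (simp add: likelihood_def pmf_positive)
  moreover have "?L \<eta> \<le> ?S"
    using \<eta> by (intro member_le_sum card_Theta_le(2)) (auto simp: likelihood_def)
  ultimately have S: "?S > 0" by linarith
  have "sum ?L ?N \<le> ?S"
    by (intro sum_mono2 card_Theta_le(2)) (auto simp: likelihood_def)
  then have "posterior n p q ?N x \<le> 1"
    using S by (simp add: posterior_def)
  moreover have "1 \<le> posterior n p q ?N x + posterior n p q ?F x"
  proof -
    have "?S \<le> sum ?L (?N \<union> ?F)"
      by (intro sum_mono2) (auto simp: likelihood_def card_Theta_le(2))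
    also have "\<dots> \<le> sum ?L ?N + sum ?L ?F"
      by (subst sum_Un) (auto simp: card_Theta_le(2) likelihood_def sum_nonneg)
    finally show ?thesis
      using S by (simp add: posterior_def flip: add_divide_distrib)
  qed
  ultimately show ?thesis by linarith
qed

theorem corollary3p5:
  fixes p q :: "nat \<Rightarrow> real" and \<theta>0 :: "nat \<Rightarrow> (nat \<Rightarrow> nat) set"
  assumes "\<And>n. n \<ge> 1 \<Longrightarrow> p n \<in> {0<..<1}"
    and "\<And>n. n \<ge> 1 \<Longrightarrow> q n \<in> {0<..<1}"
    and "\<And>n. n \<ge> 1 \<Longrightarrow> \<theta>0 n \<in> Theta n"
    and "filterlim (\<lambda>n. real n * (p n + q n - 2 * p n * q n
           - 2 * sqrt (p n * (1 - p n) * q n * (1 - q n)))) at_top sequentially"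
  shows "(\<forall>\<beta>. 0 < \<beta> \<and> \<beta> < 1/2 \<longrightarrow>
            tendsto_in_probability
              (\<lambda>n. planted_bisection n (p n) (q n) (\<theta>0 n))
              (\<lambda>n. posterior n (p n) (q n)
                 {\<theta> \<in> Theta n. real (class_dist n \<theta> (\<theta>0 n)) \<ge> \<beta> * real n})
              0) \<and>
         (\<exists>l :: nat \<Rightarrow> real. l \<in> o(\<lambda>n. real n) \<and>
            tendsto_in_probability
              (\<lambda>n. planted_bisection n (p n) (q n) (\<theta>0 n))
              (\<lambda>n. posterior n (p n) (q n)
                 {\<theta> \<in> Theta n. real (class_dist n \<theta> (\<theta>0 n)) \<le> l n})
              1)"
proof (intro conjI allI impI)
  define d where "d n = real n * separation (p n) (q n)" for n
  have d: "filterlim d at_top sequentially"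
    using assms(4) unfolding d_def separation_def .
  have far: "tendsto_in_probability (\<lambda>n. planted_bisection n (p n) (q n) (\<theta>0 n))
      (\<lambda>n. posterior n (p n) (q n)
         {\<theta> \<in> Theta n. real (class_dist n \<theta> (\<theta>0 n)) \<ge> \<beta> n * real n}) 0"
    if "filterlim (\<lambda>n. \<beta> n * d n) at_top sequentially" for \<beta>
    using that unfolding d_def by (intro posterior_far_tendsto assms(1-3)) auto
  {
    fix \<beta> :: real assume "0 < \<beta> \<and> \<beta> < 1/2"
    then have "filterlim (\<lambda>n. \<beta> * d n) at_top sequentially"
      by (intro filterlim_tendsto_pos_mult_at_top[OF tendsto_const _ d]) auto
    from far[OF this]
    show "tendsto_in_probability
              (\<lambda>n. planted_bisection n (p n) (q n) (\<theta>0 n))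
              (\<lambda>n. posterior n (p n) (q n)
                 {\<theta> \<in> Theta n. real (class_dist n \<theta> (\<theta>0 n)) \<ge> \<beta> * real n})
              0" by simp
  }
  define l where "l n = 1 / sqrt (d n) * real n" for n
  have sqrt_d: "filterlim (\<lambda>n. sqrt (d n)) at_top sequentially"
    by (rule filterlim_compose[OF sqrt_at_top d])
  have "(\<lambda>n. 1 / sqrt (d n)) \<longlonglongrightarrow> 0"
    by (rule tendsto_divide_0[OF tendsto_const filterlim_at_top_imp_at_infinity[OF sqrt_d]])
  then have "l \<in> o(\<lambda>n. real n)"
    unfolding l_def
    by (intro smalloI_tendsto) (auto simp: eventually_sequentially intro!: exI[of _ 1]
        elim!: Lim_transform_eventually)
  moreover have "tendsto_in_probability
              (\<lambda>n. planted_bisection n (p n) (q n) (\<theta>0 n))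
              (\<lambda>n. posterior n (p n) (q n)
                 {\<theta> \<in> Theta n. real (class_dist n \<theta> (\<theta>0 n)) \<le> l n}) 1"
  proof (rule tendsto_in_probability_complement)
    have "filterlim (\<lambda>n. 1 / sqrt (d n) * d n) at_top sequentially"
    proof (rule filterlim_at_top_mono[OF sqrt_d])
      show "\<forall>\<^sub>F n in sequentially. sqrt (d n) \<le> 1 / sqrt (d n) * d n"
        using filterlim_at_top[THEN iffD1, rule_format, OF d, of 0]
        by eventually_elim (simp add: real_div_sqrt)
    qed
    from far[OF this]
    show "tendsto_in_probability
              (\<lambda>n. planted_bisection n (p n) (q n) (\<theta>0 n))
              (\<lambda>n. posterior n (p n) (q n)
                 {\<theta> \<in> Theta n. real (class_dist n \<theta> (\<theta>0 n)) \<ge> l n}) 0"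
      by (simp add: l_def)
    show "\<forall>\<^sub>F n in sequentially. \<forall>x\<in>set_pmf (planted_bisection n (p n) (q n) (\<theta>0 n)).
       \<bar>posterior n (p n) (q n) {\<theta> \<in> Theta n. real (class_dist n \<theta> (\<theta>0 n)) \<le> l n} x - 1\<bar>
       \<le> \<bar>posterior n (p n) (q n) {\<theta> \<in> Theta n. real (class_dist n \<theta> (\<theta>0 n)) \<ge> l n} x\<bar>"
      using eventually_ge_at_top[of 1] by eventually_elim (blast intro: posterior_near_error_le assms(3))
  qed
  ultimately show "\<exists>l :: nat \<Rightarrow> real. l \<in> o(\<lambda>n. real n) \<and>
            tendsto_in_probability
              (\<lambda>n. planted_bisection n (p n) (q n) (\<theta>0 n))
              (\<lambda>n. posterior n (p n) (q n)
                 {\<theta> \<in> Theta n. real (class_dist n \<theta> (\<theta>0 n)) \<le> l n})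
              1" by blast
qed

end
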